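(* Let $\bar\lambda=\langle\lambda_i: i<\kappa\rangle$ be a sequence of infinite regular cardinals, $I^*$ an ideal on $\kappa$ and $\theta$ a cardinal such that at least one of the following holds: ($\alpha$) $\min_{i<\kappa}\lambda_i>\theta\ge \mathrm{wsat}(I^* )$; or ($\beta$) $\liminf_{I^*}(\bar\lambda)\ge\theta\ge\mathrm{wsat}(I^* )$ and $(\prod\bar\lambda,\le_{I^*})$ is $\theta^+$-directed. If $\lambda$ is a cardinal with $\lambda\ge\theta$ and $\kappa\notin J_{<\lambda}[\bar\lambda]$, then $(\prod\bar\lambda,<_{J_{<\lambda}[\bar\lambda]})$ is $\lambda$-directed.
   Context: $\kappa$ is an infinite cardinal; $I^*$ is a proper ideal on $\kappa$; $\prod\bar\lambda=\prod_{i<\kappa}\lambda_i$. For an ideal $J$ on $\kappa$ and ordinal-valued functions $f,g$ on $\kappa$: $f<_J g$ (also written $f<g \bmod J$) means $\{i<\kappa:\neg f(i)<g(i)\}\in J$; similarly for $\le_J$, $=_J$. For a filter $D$, $<_D$ etc. refer to the dual ideal, and $\prod\bar\lambda/D$ is the corresponding ordered reduced product. $J^+=\mathcal P(\kappa)\setminus J$. A (quasi-)partial order $P$ is $\lambda$-directed if every $A\subseteq P$ with $|A|<\lambda$ has an upper bound in $P$. $P$ has true cofinality $\lambda$ if there is a strictly increasing sequence $\langle p_\alpha:\alpha<\lambda\rangle$ in $P$ such that every $q\in P$ satisfies $q\le p_\alpha$ for some $\alpha$; $\mathrm{tcf}(P)$ is the least such $\lambda$ (for an ultrafilter $D$ it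 is always well defined for $\prod\bar\lambda/D$). $\liminf_{I}(\bar\lambda)=\min\{\mu:\{i<\kappa:\lambda_i\le\mu\}\in I^+\}$. $\mathrm{wsat}(I)$ is the least cardinal $\theta$ such that $\kappa$ cannot be partitioned into $\theta$ pairwise disjoint sets each in $I^+$. $J_{<\lambda}[\bar\lambda]=\{B\subseteq\kappa:$ there is no ultrafilter $D$ on $\kappa$ with $D\cap I^*=\emptyset$, $B\in D$ and $\mathrm{tcf}(\prod\bar\lambda/D)\ge\lambda\}$; it is a (possibly improper) ideal on $\kappa$ extending $I^*$. *)

theory Defs
  imports Main "HOL-Library.FuncSet" "HOL-Library.Disjoint_Sets"
begin

unbundle cardinal_syntax

text \<open>
  Cardinals are relations \<open>r\<close> with \<open>Card_order r\<close>, compared by \<open>\<le>o\<close>, \<open><o\<close>, \<open>=o\<close>; the ordinals below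
  \<open>r\<close> are the elements of \<open>Field r\<close>, ordered by \<open>r\<close>. Throughout, \<open>K\<close> is the index set (the field of
  the cardinal \<open>\<kappa>\<close>) and \<open>L i\<close> is the cardinal with index \<open>i\<close>.
\<close>

text \<open>The least cardinal in \<open>R\<close>, which is determined up to \<open>=o\<close>; arbitrary if \<open>R\<close> is empty.\<close>

definition min_card :: "'a rel set \<Rightarrow> 'a rel" where
  "min_card R = (SOME r. r \<in> R \<and> (\<forall>r'\<in>R. r \<le>o r'))"

definition ideal_on :: "'k set \<Rightarrow> 'k set set \<Rightarrow> bool" where
  "ideal_on K J \<longleftrightarrow> J \<subseteq> Pow K \<and> {} \<in> J \<and>
     (\<forall>A\<in>J. \<forall>B. B \<subseteq> A \<longrightarrow> B \<in> J) \<and> (\<forall>A\<in>J. \<forall>B\<in>J. A \<union> B \<in> J)"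

definition proper_ideal_on :: "'k set \<Rightarrow> 'k set set \<Rightarrow> bool" where
  "proper_ideal_on K J \<longleftrightarrow> ideal_on K J \<and> K \<notin> J"

definition positive :: "'k set \<Rightarrow> 'k set set \<Rightarrow> 'k set set" where
  "positive K J = Pow K - J"

definition filter_on :: "'k set \<Rightarrow> 'k set set \<Rightarrow> bool" where
  "filter_on K D \<longleftrightarrow> D \<subseteq> Pow K \<and> K \<in> D \<and>
     (\<forall>A\<in>D. \<forall>B. A \<subseteq> B \<and> B \<subseteq> K \<longrightarrow> B \<in> D) \<and> (\<forall>A\<in>D. \<forall>B\<in>D. A \<inter> B \<in> D)"

definition ultrafilter_on :: "'k set \<Rightarrow> 'k set set \<Rightarrow> bool" where
  "ultrafilter_on K D \<longleftrightarrow> filter_on K D \<and> {} \<notin> D \<and> (\<forall>A. A \<subseteq> K \<longrightarrow> A \<in> D \<or> K - A \<in> D)"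

definition dual_ideal :: "'k set \<Rightarrow> 'k set set \<Rightarrow> 'k set set" where
  "dual_ideal K D = {A. A \<subseteq> K \<and> K - A \<in> D}"

definition card_prod :: "'k set \<Rightarrow> ('k \<Rightarrow> 'a rel) \<Rightarrow> ('k \<Rightarrow> 'a) set" where
  "card_prod K L = (\<Pi>\<^sub>E i\<in>K. Field (L i))"

definition less_mod :: "'k set \<Rightarrow> ('k \<Rightarrow> 'a rel) \<Rightarrow> 'k set set \<Rightarrow> ('k \<Rightarrow> 'a) rel" where
  "less_mod K L J = {(f, g). f \<in> card_prod K L \<and> g \<in> card_prod K L \<and>
     {i\<in>K. \<not> ((f i, g i) \<in> L i \<and> f i \<noteq> g i)} \<in> J}"

definition le_mod :: "'k set \<Rightarrow> ('k \<Rightarrow> 'a rel) \<Rightarrow> 'k set set \<Rightarrow> ('k \<Rightarrow> 'a) rel" where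
  "le_mod K L J = {(f, g). f \<in> card_prod K L \<and> g \<in> card_prod K L \<and>
     {i\<in>K. (f i, g i) \<notin> L i} \<in> J}"

definition eq_mod :: "'k set \<Rightarrow> ('k \<Rightarrow> 'a rel) \<Rightarrow> 'k set set \<Rightarrow> ('k \<Rightarrow> 'a) rel" where
  "eq_mod K L J = {(f, g). f \<in> card_prod K L \<and> g \<in> card_prod K L \<and>
     {i\<in>K. f i \<noteq> g i} \<in> J}"

text \<open>
  The upper bound is taken with respect to the relation \<open>R\<close> itself, so for a strict order \<open>R\<close> it is
  a strict upper bound.
\<close>

definition directed_below :: "'p set \<Rightarrow> 'p rel \<Rightarrow> 'l rel \<Rightarrow> bool" where
  "directed_below P R \<mu> \<longleftrightarrow> (\<forall>A. A \<subseteq> P \<and> |A| <o \<mu> \<longrightarrow> (\<exists>p\<in>P. \<forall>a\<in>A. (a, p) \<in> R))"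

text \<open>\<open>R\<close> is the non-strict quasi-order of \<open>P\<close>; strictly increasing refers to its strict part.\<close>

definition has_true_cofinality :: "'p set \<Rightarrow> 'p rel \<Rightarrow> 'l rel \<Rightarrow> bool" where
  "has_true_cofinality P R \<mu> \<longleftrightarrow> Card_order \<mu> \<and>
     (\<exists>p. (\<forall>\<alpha>\<in>Field \<mu>. p \<alpha> \<in> P) \<and>
          (\<forall>\<alpha> \<beta>. (\<alpha>, \<beta>) \<in> \<mu> \<and> \<alpha> \<noteq> \<beta> \<longrightarrow> (p \<alpha>, p \<beta>) \<in> R \<and> (p \<beta>, p \<alpha>) \<notin> R) \<and>
          (\<forall>q\<in>P. \<exists>\<alpha>\<in>Field \<mu>. (q, p \<alpha>) \<in> R))"

text \<open>
  A strictly increasing sequence is injective, so every true cofinality of \<open>P\<close> is at most \<open>|P|\<close> and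
  is represented by a cardinal on the type of the elements of \<open>P\<close>.
\<close>

definition tcf :: "'p set \<Rightarrow> 'p rel \<Rightarrow> 'p rel" where
  "tcf P R = min_card {\<mu>. has_true_cofinality P R \<mu>}"

definition reduced_prod :: "'k set \<Rightarrow> ('k \<Rightarrow> 'a rel) \<Rightarrow> 'k set set \<Rightarrow> ('k \<Rightarrow> 'a) set set" where
  "reduced_prod K L D = card_prod K L // eq_mod K L (dual_ideal K D)"

text \<open>For an ultrafilter \<open>D\<close> the strict part of this order is induced by \<open><\<close> modulo \<open>D\<close>.\<close>

definition reduced_le :: "'k set \<Rightarrow> ('k \<Rightarrow> 'a rel) \<Rightarrow> 'k set set \<Rightarrow> ('k \<Rightarrow> 'a) set rel" where
  "reduced_le K L D = {(X, Y). X \<in> reduced_prod K L D \<and> Y \<in> reduced_prod K L D \<and>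
     (\<exists>f\<in>X. \<exists>g\<in>Y. (f, g) \<in> le_mod K L (dual_ideal K D))}"

text \<open>
  Every \<open>L i\<close> is at most the cardinality of the type \<open>'a\<close>, so the minimum over all cardinals is
  attained by a cardinal on \<open>'a\<close>.
\<close>

definition liminf_card :: "'k set \<Rightarrow> 'k set set \<Rightarrow> ('k \<Rightarrow> 'a rel) \<Rightarrow> 'a rel" where
  "liminf_card K I L = min_card {\<mu>. Card_order \<mu> \<and> {i\<in>K. L i \<le>o \<mu>} \<in> positive K I}"

text \<open>
  The cardinal 0 is excluded: a nonempty set has no partition into 0 sets, so the minimum would be 0
  for every ideal. A partition of \<open>K\<close> has at most \<open>|K|\<close> blocks, so the minimum is at most the
  cardinality of \<open>'k set\<close>.
\<close>

definition wsat :: "'k set \<Rightarrow> 'k set set \<Rightarrow> 'k set rel" where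
  "wsat K I = min_card {\<theta>. Card_order \<theta> \<and> Field \<theta> \<noteq> {} \<and>
     \<not> (\<exists>P. partition_on K P \<and> P \<subseteq> positive K I \<and> |P| =o \<theta>)}"

definition J_less :: "'k set \<Rightarrow> 'k set set \<Rightarrow> ('k \<Rightarrow> 'a rel) \<Rightarrow> 'l rel \<Rightarrow> 'k set set" where
  "J_less K I L lam = {B. B \<subseteq> K \<and>
     \<not> (\<exists>D. ultrafilter_on K D \<and> D \<inter> I = {} \<and> B \<in> D \<and>
          lam \<le>o tcf (reduced_prod K L D) (reduced_le K L D))}"

end

theory Submission
  imports Defs
begin

text \<open>
  Write \<open>J\<close> for \<open>J_less K I L lam\<close>, \<open><\<^sub>J\<close> and \<open>\<le>\<^sub>J\<close> for the orders modulo \<open>J\<close>, and call a family of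
  functions bounded if it has an upper bound modulo \<open>J\<close>. As the \<open>L i\<close> are limit ordinals, \<open>p <\<^sub>J p + 1\<close>
  for every \<open>p\<close>, so bounds for \<open>\<le>\<^sub>J\<close> are enough (\<open>less_mod_directed\<close>). Both alternatives of the hypothesis
  provide the same two facts: families of size at most \<open>\<theta>\<close> are bounded, and for every ordinal
  \<open>e < \<theta>\<close> the indices \<open>i\<close> with \<open>L i \<le> |e|\<close> form a set in \<open>I\<close>. So away from a set in \<open>I\<close>, regularity
  gives pointwise upper bounds of \<open>|e|\<close> many functions.

  Suppose that some family of fewer than \<open>lam\<close> functions is unbounded, and let \<open>F\<close> be one of least
  size, well-ordered in type \<open>|F|\<close>. By minimality every initial segment of \<open>F\<close> up to and including
  \<open>a\<close> has a bound \<open>up a\<close>. A function \<open>g\<close> does not bound \<open>F\<close>, so some \<open>a \<in> F\<close> exceeds \<open>g\<close> on a set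
  outside \<open>J\<close>; by the definition of \<open>J\<close> this set lies in an ultrafilter \<open>D\<close> disjoint from \<open>I\<close> with
  \<open>tcf (\<Prod>L/D) \<ge> lam\<close>. Such a \<open>D\<close> is disjoint from \<open>J\<close> by definition, and all the functions \<open>up b\<close>
  are bounded modulo \<open>D\<close> by one function \<open>H g\<close>: in a linear order whose true cofinality is
  at least \<open>lam\<close>, fewer than \<open>lam\<close> elements are bounded (\<open>tcf_directed\<close>).

  By recursion on \<open>e < \<theta>\<close>, let \<open>g e\<close> be a pointwise upper bound of the functions \<open>H (g z)\<close>, \<open>z < e\<close>.
  At most \<open>\<theta> < |F|\<close> members of \<open>F\<close> witness that the functions \<open>g e\<close> do not bound \<open>F\<close>, and these are not
  cofinal in \<open>F\<close> (otherwise the bounds \<open>up a\<close> of the witnesses \<open>a\<close> would have a bound by minimality,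
  and that would bound \<open>F\<close>). So a single \<open>b \<in> F\<close> lies above all witnesses. The sets
  \<open>{i. g e i < up b i \<le> H (g e) i}\<close> are then positive, since they belong to the ultrafilters chosen for
  \<open>g e\<close>, and after removing a set in \<open>I\<close> from each they are disjoint, because \<open>g e\<close> is above the
  earlier \<open>H (g z)\<close>. Hence \<open>\<theta>\<close> many disjoint positive sets exist, contradicting \<open>wsat K I \<le> \<theta>\<close>
  (\<open>wsat_no_disjoint_family\<close>).
\<close>

section \<open>Cardinals\<close>

lemma card_order_props:
  assumes "Card_order r"
  shows "Refl r" "trans r" "antisym r" "Total r" "wf (r - Id)" "Well_order r"
  using assms unfolding card_order_on_def well_order_on_def linear_order_on_def partial_order_on_def
    preorder_on_def by auto

lemma min_card_least:
  assumes "r \<in> R" and "\<And>r. r \<in> R \<Longrightarrow> Card_order r"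
  shows "min_card R \<in> R" and "\<And>r'. r' \<in> R \<Longrightarrow> min_card R \<le>o r'"
proof -
  have "\<exists>r. r \<in> R \<and> (\<forall>r'\<in>R. r \<le>o r')"
    using exists_minim_Well_order[of R] assms card_order_props(6) by blast
  from someI_ex[OF this] show "min_card R \<in> R" "\<And>r'. r' \<in> R \<Longrightarrow> min_card R \<le>o r'"
    unfolding min_card_def by auto
qed

lemma regularCard_bounded:
  assumes r: "Card_order r" "regularCard r" and X: "X \<subseteq> Field r" "|X| <o r"
  shows "\<exists>b\<in>Field r. \<forall>x\<in>X. (x, b) \<in> r"
proof -
  have "\<not> cofinal X r"
    using r X not_ordLess_ordIso unfolding regularCard_def by blast
  then obtain b where b: "b \<in> Field r" "\<forall>x\<in>X. b = x \<or> (b, x) \<notin> r"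
    unfolding cofinal_def by blast
  have "(x, b) \<in> r" if "x \<in> X" for x
    using b X(1) that card_order_props(1,4)[OF r(1)] unfolding total_on_def refl_on_def
    by (metis subsetD)
  then show ?thesis using b by blast
qed

lemma exists_set_of_least_card:
  assumes "Q C"
  obtains B where "Q B" "\<And>X. Q X \<Longrightarrow> |B| \<le>o |X|"
proof -
  have "\<exists>r\<in>{|X| |X. Q X}. \<forall>r'\<in>{|X| |X. Q X}. r \<le>o r'"
    using assms card_of_Well_order by (intro exists_minim_Well_order) auto
  then show thesis using that by blast
qed

section \<open>Directedness and true cofinality\<close>

lemma directed_belowD:
  assumes "directed_below P R \<mu>" "A \<subseteq> P" "|A| <o \<mu>"
  obtains p where "p \<in> P" "\<And>a. a \<in> A \<Longrightarrow> (a, p) \<in> R"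
  using assms unfolding directed_below_def by meson

text \<open>
  Take a cofinal subset \<open>B\<close> of least size and walk through it in order type \<open>|B|\<close>, going above the
  current element of \<open>B\<close> and strictly above everything chosen before. The latter is possible
  because fewer than \<open>|B|\<close> elements are not cofinal, and in a linear order this means that they are
  strictly bounded. If the order has a greatest element, \<open>B\<close> is a singleton and nothing was
  chosen before.
\<close>

lemma linear_has_true_cofinality:
  fixes R :: "'p rel"
  assumes R: "refl_on P R" "trans R" "total_on P R"
    and C: "C \<subseteq> P" "\<And>q. q \<in> P \<Longrightarrow> \<exists>c\<in>C. (q, c) \<in> R"
  shows "\<exists>\<nu> :: 'p rel. has_true_cofinality P R \<nu> \<and> \<nu> \<le>o |C|"
proof -
  define cofin where "cofin X \<longleftrightarrow> X \<subseteq> P \<and> (\<forall>q\<in>P. \<exists>c\<in>X. (q, c) \<in> R)" for X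
  have "cofin C" using C by (auto simp: cofin_def)
  then obtain B where B: "cofin B" and least: "\<And>X. cofin X \<Longrightarrow> |B| \<le>o |X|"
    using exists_set_of_least_card[of cofin C] by blast
  let ?nu = "|B|"
  have nu: "Card_order ?nu" "Field ?nu = B" by (simp_all add: card_of_card_order_on Field_card_of)
  note ord = card_order_props[OF nu(1)]
  define next_ok where "next_ok p \<alpha> x \<longleftrightarrow> (\<alpha> \<in> B \<longrightarrow> x \<in> P \<and> (\<alpha>, x) \<in> R \<and>
      (\<forall>\<beta>\<in>underS ?nu \<alpha>. (p \<beta>, x) \<in> R \<and> (x, p \<beta>) \<notin> R))" for p :: "'p \<Rightarrow> 'p" and \<alpha> x
  have "\<exists>p. \<forall>\<alpha>. next_ok p \<alpha> (p \<alpha>)"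
  proof (rule dependent_wf_choice[OF ord(5)])
    fix f g :: "'p \<Rightarrow> 'p" and x r
    assume "\<And>z. (z, x) \<in> ?nu - Id \<Longrightarrow> f z = g z"
    then have "f z = g z" if "z \<in> underS ?nu x" for z
      using that by (auto simp: underS_def)
    then show "next_ok f x r = next_ok g x r"
      unfolding next_ok_def by auto
  next
    fix \<alpha> f
    assume IH: "\<And>y. (y, \<alpha>) \<in> ?nu - Id \<Longrightarrow> next_ok f y (f y)"
    show "\<exists>x. next_ok f \<alpha> x"
    proof (cases "\<alpha> \<in> B")
      case True
      let ?S = "f ` underS ?nu \<alpha>"
      have below: "f \<beta> \<in> P" if "\<beta> \<in> underS ?nu \<alpha>" for \<beta>
        using that IH[of \<beta>] underS_Field[of \<beta> ?nu \<alpha>] by (auto simp: underS_def next_ok_def nu(2))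
      have "|underS ?nu \<alpha>| <o ?nu" using True by (intro card_of_underS[OF nu(1)]) (simp add: nu(2))
      then have "|?S| <o |B|" using card_of_image ordLeq_ordLess_trans by blast
      then have "\<not> cofin ?S"
        using least not_ordLess_ordLeq by blast
      then obtain q where q: "q \<in> P" "\<And>\<beta>. \<beta> \<in> underS ?nu \<alpha> \<Longrightarrow> (q, f \<beta>) \<notin> R"
        using below unfolding cofin_def by blast
      have f_le_q: "(f \<beta>, q) \<in> R" if "\<beta> \<in> underS ?nu \<alpha>" for \<beta>
        using q below that R(1,3) unfolding total_on_def refl_on_def by metis
      have aP: "\<alpha> \<in> P" using True B by (auto simp: cofin_def)
      show ?thesis
        \<comment> \<open>The larger of \<open>q\<close> and \<open>\<alpha>\<close> is a valid next value.\<close>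
      proof (cases "(q, \<alpha>) \<in> R")
        case True
        then have "next_ok f \<alpha> \<alpha>"
          using aP R(1) f_le_q q(2) R(2) unfolding next_ok_def refl_on_def trans_def by blast
        then show ?thesis ..
      next
        case False
        then have "(\<alpha>, q) \<in> R" using aP q(1) R(1,3) unfolding total_on_def refl_on_def by metis
        then have "next_ok f \<alpha> q" using f_le_q q unfolding next_ok_def by blast
        then show ?thesis ..
      qed
    qed (auto simp: next_ok_def)
  qed
  then obtain p where p: "\<And>\<alpha>. next_ok p \<alpha> (p \<alpha>)" by blast
  have pB: "p \<alpha> \<in> P" "(\<alpha>, p \<alpha>) \<in> R" if "\<alpha> \<in> B" for \<alpha>
    using p[of \<alpha>] that by (auto simp: next_ok_def)
  have "has_true_cofinality P R ?nu"
    unfolding has_true_cofinality_def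
  proof (intro conjI exI[of _ p] ballI allI impI)
    show "Card_order ?nu" by (fact nu(1))
    show "p \<alpha> \<in> P" if "\<alpha> \<in> Field ?nu" for \<alpha> using that pB nu(2) by blast
  next
    fix \<alpha> \<beta> assume ab: "(\<alpha>, \<beta>) \<in> ?nu \<and> \<alpha> \<noteq> \<beta>"
    then have "\<beta> \<in> B" "\<alpha> \<in> underS ?nu \<beta>" using nu(2) by (auto simp: underS_def Field_def)
    then show "(p \<alpha>, p \<beta>) \<in> R" "(p \<beta>, p \<alpha>) \<notin> R"
      using p[of \<beta>] by (auto simp: next_ok_def)
  next
    fix q assume "q \<in> P"
    then obtain c where "c \<in> B" "(q, c) \<in> R" using B by (auto simp: cofin_def)
    then show "\<exists>\<alpha>\<in>Field ?nu. (q, p \<alpha>) \<in> R"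
      using pB(2)[of c] R(2) nu(2) by (metis transD)
  qed
  moreover have "?nu \<le>o |C|" using least \<open>cofin C\<close> by blast
  ultimately show ?thesis by blast
qed

text \<open>
  In a linear order a set without an upper bound is cofinal, and then there is a true cofinality of
  at most its size. This also gives the existence of a true cofinality, without which
  \<^const>\<open>tcf\<close> would be an arbitrary relation; and it covers a singular true cofinality, for which the
  cofinal sequence alone would not bound all smaller sets.
\<close>

lemma tcf_directed:
  fixes R :: "'p rel"
  assumes R: "refl_on P R" "trans R" "total_on P R" and lam: "lam \<le>o tcf P R"
  shows "directed_below P R lam"
  unfolding directed_below_def
proof (intro allI impI, elim conjE, rule ccontr)
  fix A assume A: "A \<subseteq> P" "|A| <o lam" and no: "\<not> (\<exists>p\<in>P. \<forall>a\<in>A. (a, p) \<in> R)"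
  have "\<exists>a\<in>A. (q, a) \<in> R" if "q \<in> P" for q
    using that no A(1) R(1,3) unfolding total_on_def refl_on_def by (metis subsetD)
  then obtain \<nu> :: "'p rel" where \<nu>: "has_true_cofinality P R \<nu>" "\<nu> \<le>o |A|"
    using linear_has_true_cofinality[OF R A(1)] by blast
  have "tcf P R \<le>o \<nu>"
    unfolding tcf_def using \<nu>(1) by (intro min_card_least(2)) (auto simp: has_true_cofinality_def)
  then have "lam \<le>o |A|" using lam \<nu>(2) ordLeq_transitive by blast
  then show False using A(2) not_ordLess_ordLeq by blast
qed

section \<open>Products modulo an ideal\<close>

lemma ideal_onD:
  assumes "ideal_on K J"
  shows "{} \<in> J" "\<And>A B. A \<in> J \<Longrightarrow> B \<subseteq> A \<Longrightarrow> B \<in> J" "\<And>A B. A \<in> J \<Longrightarrow> B \<in> J \<Longrightarrow> A \<union> B \<in> J"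
    "\<And>A. A \<in> J \<Longrightarrow> A \<subseteq> K"
  using assms unfolding ideal_on_def by blast+

lemma filter_onD:
  assumes "filter_on K D"
  shows "K \<in> D" "\<And>A B. A \<in> D \<Longrightarrow> A \<subseteq> B \<Longrightarrow> B \<subseteq> K \<Longrightarrow> B \<in> D"
    "\<And>A B. A \<in> D \<Longrightarrow> B \<in> D \<Longrightarrow> A \<inter> B \<in> D"
  using assms unfolding filter_on_def by blast+

lemma ideal_on_dual_ideal:
  assumes D: "filter_on K D"
  shows "ideal_on K (dual_ideal K D)"
  unfolding ideal_on_def dual_ideal_def
proof (intro conjI ballI allI impI; clarsimp)
  show "K \<in> D" by (rule filter_onD(1)[OF D])
next
  fix A B assume *: "A \<subseteq> K" "K - A \<in> D" "B \<subseteq> A"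
  then have "K - A \<subseteq> K - B" "B \<subseteq> K" by blast+
  then show "B \<subseteq> K \<and> K - B \<in> D" using filter_onD(2)[OF D *(2)] by blast
next
  fix A B assume "A \<subseteq> K" "K - A \<in> D" "B \<subseteq> K" "K - B \<in> D"
  then show "K - (A \<union> B) \<in> D" using filter_onD(3)[OF D] unfolding Diff_Un by blast
qed auto

lemma trans_le_mod:
  assumes J: "ideal_on K J" and L: "\<And>i. i \<in> K \<Longrightarrow> Card_order (L i)"
  shows "trans (le_mod K L J)"
proof (rule transI)
  fix f g h assume *: "(f, g) \<in> le_mod K L J" "(g, h) \<in> le_mod K L J"
  have "{i\<in>K. (f i, h i) \<notin> L i} \<subseteq> {i\<in>K. (f i, g i) \<notin> L i} \<union> {i\<in>K. (g i, h i) \<notin> L i}"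
    using card_order_props(2)[OF L] unfolding trans_def by blast
  moreover have "{i\<in>K. (f i, g i) \<notin> L i} \<union> {i\<in>K. (g i, h i) \<notin> L i} \<in> J"
    using * ideal_onD(3)[OF J] by (auto simp: le_mod_def)
  ultimately show "(f, h) \<in> le_mod K L J"
    using * ideal_onD(2)[OF J] by (auto simp: le_mod_def)
qed

lemma le_mod_pointwiseI:
  assumes "ideal_on K J" "f \<in> card_prod K L" "g \<in> card_prod K L" "\<And>i. i \<in> K \<Longrightarrow> (f i, g i) \<in> L i"
  shows "(f, g) \<in> le_mod K L J"
proof -
  have *: "{i\<in>K. (f i, g i) \<notin> L i} = {}" using assms(4) by blast
  show ?thesis using assms(2,3) ideal_onD(1)[OF assms(1)] unfolding le_mod_def mem_Collect_eq prod.case *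
    by blast
qed

lemma card_prod_refl:
  assumes "f \<in> card_prod K L" "i \<in> K" "Card_order (L i)"
  shows "(f i, f i) \<in> L i"
  using assms card_order_props(1)[OF assms(3)] by (auto simp: card_prod_def refl_on_def)

lemma card_prod_choice:
  assumes "\<And>i. i \<in> K \<Longrightarrow> \<exists>b\<in>Field (L i). Q i b"
  shows "\<exists>f\<in>card_prod K L. \<forall>i\<in>K. Q i (f i)"
proof -
  obtain f where "\<forall>i\<in>K. f i \<in> Field (L i) \<and> Q i (f i)"
    using assms bchoice[of K "\<lambda>i b. b \<in> Field (L i) \<and> Q i b"] by blast
  then show ?thesis
    by (intro bexI[of _ "restrict f K"]) (auto simp: card_prod_def)
qed

lemma card_prod_sup:
  assumes L: "\<And>i. i \<in> K \<Longrightarrow> Card_order (L i)"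
    and f: "f \<in> card_prod K L" and g: "g \<in> card_prod K L"
  shows "\<exists>m\<in>card_prod K L. \<forall>i\<in>K. (f i, m i) \<in> L i \<and> (g i, m i) \<in> L i"
proof (rule card_prod_choice)
  fix i assume i: "i \<in> K"
  then have "f i \<in> Field (L i)" "g i \<in> Field (L i)" using f g by (auto simp: card_prod_def)
  then show "\<exists>b\<in>Field (L i). (f i, b) \<in> L i \<and> (g i, b) \<in> L i"
    using card_order_props(1,4)[OF L[OF i]] unfolding total_on_def refl_on_def by metis
qed

lemma less_mod_directed:
  assumes J: "ideal_on K J" and L: "\<And>i. i \<in> K \<Longrightarrow> Card_order (L i) \<and> cinfinite (L i)"
    and dir: "directed_below (card_prod K L) (le_mod K L J) \<mu>"
  shows "directed_below (card_prod K L) (less_mod K L J) \<mu>"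
  unfolding directed_below_def
proof (intro allI impI)
  fix A assume A: "A \<subseteq> card_prod K L \<and> |A| <o \<mu>"
  then obtain p where p: "p \<in> card_prod K L" "\<And>a. a \<in> A \<Longrightarrow> (a, p) \<in> le_mod K L J"
    using A directed_belowD[OF dir] by metis
  obtain q where q: "q \<in> card_prod K L" "\<And>i. i \<in> K \<Longrightarrow> p i \<noteq> q i \<and> (p i, q i) \<in> L i"
  proof -
    have "\<exists>b\<in>Field (L i). p i \<noteq> b \<and> (p i, b) \<in> L i" if "i \<in> K" for i
      using infinite_Card_order_limit[of "L i" "p i"] L[OF that] p(1) that
      by (auto simp: card_prod_def cinfinite_def)
    from card_prod_choice[of K L, OF this] that show thesis by auto
  qed
  have "(a, q) \<in> less_mod K L J" if a: "a \<in> A" for a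
  proof -
    have "{i\<in>K. \<not> ((a i, q i) \<in> L i \<and> a i \<noteq> q i)} \<subseteq> {i\<in>K. (a i, p i) \<notin> L i}"
    proof (intro subsetI CollectI conjI notI; clarsimp)
      fix i assume i: "i \<in> K" "(a i, p i) \<in> L i" "(a i, q i) \<in> L i \<longrightarrow> a i = q i"
      then show False
        using q(2)[OF i(1)] card_order_props(2,3)[of "L i"] L[OF i(1)]
        unfolding trans_def antisym_def by metis
    qed
    then show ?thesis
      using p(2)[OF a] q(1) ideal_onD(2)[OF J] by (auto simp: le_mod_def less_mod_def)
  qed
  then show "\<exists>p\<in>card_prod K L. \<forall>a\<in>A. (a, p) \<in> less_mod K L J" using q(1) by blast
qed

section \<open>Reduced products by ultrafilters\<close>

lemma ultrafilter_onD:
  assumes "ultrafilter_on K D"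
  shows "filter_on K D" "{} \<notin> D" "\<And>A. A \<subseteq> K \<Longrightarrow> A \<in> D \<or> K - A \<in> D"
    "\<And>A B. A \<in> D \<Longrightarrow> A \<subseteq> B \<Longrightarrow> B \<subseteq> K \<Longrightarrow> B \<in> D" "\<And>A B. A \<in> D \<Longrightarrow> B \<in> D \<Longrightarrow> A \<inter> B \<in> D"
  using assms unfolding ultrafilter_on_def filter_on_def by blast+

lemma le_mod_dual_ideal_iff:
  "(f, g) \<in> le_mod K L (dual_ideal K D) \<longleftrightarrow>
     f \<in> card_prod K L \<and> g \<in> card_prod K L \<and> {i\<in>K. (f i, g i) \<in> L i} \<in> D"
proof -
  have "K - {i\<in>K. (f i, g i) \<notin> L i} = {i\<in>K. (f i, g i) \<in> L i}" by blast
  then show ?thesis by (auto simp: le_mod_def dual_ideal_def)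
qed

lemma equiv_eq_mod:
  assumes J: "ideal_on K J"
  shows "equiv (card_prod K L) (eq_mod K L J)"
proof (rule equivI)
  show "eq_mod K L J \<subseteq> card_prod K L \<times> card_prod K L" by (auto simp: eq_mod_def)
  show "refl_on (card_prod K L) (eq_mod K L J)"
    using ideal_onD(1)[OF J] by (auto simp: refl_on_def eq_mod_def)
  show "sym (eq_mod K L J)" by (auto simp: sym_def eq_mod_def eq_commute)
  show "trans (eq_mod K L J)"
  proof (rule transI)
    fix f g h assume *: "(f, g) \<in> eq_mod K L J" "(g, h) \<in> eq_mod K L J"
    have "{i\<in>K. f i \<noteq> h i} \<subseteq> {i\<in>K. f i \<noteq> g i} \<union> {i\<in>K. g i \<noteq> h i}" by auto
    moreover have "{i\<in>K. f i \<noteq> g i} \<union> {i\<in>K. g i \<noteq> h i} \<in> J"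
      using * ideal_onD(3)[OF J] by (auto simp: eq_mod_def)
    ultimately show "(f, h) \<in> eq_mod K L J"
      using * ideal_onD(2)[OF J] by (auto simp: eq_mod_def)
  qed
qed

lemma eq_mod_imp_le_mod:
  assumes J: "ideal_on K J" and L: "\<And>i. i \<in> K \<Longrightarrow> Card_order (L i)" and "(f, g) \<in> eq_mod K L J"
  shows "(f, g) \<in> le_mod K L J"
proof -
  have "{i\<in>K. (f i, g i) \<notin> L i} \<subseteq> {i\<in>K. f i \<noteq> g i}"
    using assms(3) card_prod_refl[of _ K L] L by (auto simp: eq_mod_def)
  then show ?thesis using assms(3) ideal_onD(2)[OF J] by (auto simp: eq_mod_def le_mod_def)
qed

text \<open>
  The order of the reduced product does not depend on representatives, so it can be computed on any
  of them.
\<close>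

lemma reduced_le_iff:
  assumes D: "filter_on K D" and L: "\<And>i. i \<in> K \<Longrightarrow> Card_order (L i)"
    and X: "X \<in> reduced_prod K L D" "f \<in> X" and Y: "Y \<in> reduced_prod K L D" "g \<in> Y"
  shows "(X, Y) \<in> reduced_le K L D \<longleftrightarrow> (f, g) \<in> le_mod K L (dual_ideal K D)"
proof
  let ?J = "dual_ideal K D"
  have J: "ideal_on K ?J" by (rule ideal_on_dual_ideal[OF D])
  note eqv = equiv_eq_mod[OF J, of L]
  assume "(X, Y) \<in> reduced_le K L D"
  then obtain f' g' where *: "f' \<in> X" "g' \<in> Y" "(f', g') \<in> le_mod K L ?J"
    by (auto simp: reduced_le_def)
  have "(f, f') \<in> eq_mod K L ?J" "(g', g) \<in> eq_mod K L ?J"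
    using quotient_eq_iff[OF eqv] X Y *(1,2) unfolding reduced_prod_def by blast+
  then have "(f, f') \<in> le_mod K L ?J" "(g', g) \<in> le_mod K L ?J"
    using eq_mod_imp_le_mod[where L=L, OF J L] by blast+
  then show "(f, g) \<in> le_mod K L ?J"
    using *(3) trans_le_mod[where L=L, OF J L] by (meson transD)
qed (use X Y in \<open>auto simp: reduced_le_def\<close>)

lemma reduced_prod_rep:
  assumes D: "filter_on K D" and X: "X \<in> reduced_prod K L D"
  shows "\<exists>f\<in>X. f \<in> card_prod K L"
  using X equiv_eq_mod[OF ideal_on_dual_ideal[OF D], of L]
  unfolding reduced_prod_def by (meson Union_quotient UnionI equiv_Eps_in subsetD subset_refl in_quotient_imp_subset)

lemma reduced_le_linear:
  assumes D: "ultrafilter_on K D" and L: "\<And>i. i \<in> K \<Longrightarrow> Card_order (L i)"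
  shows "refl_on (reduced_prod K L D) (reduced_le K L D)" "trans (reduced_le K L D)"
    "total_on (reduced_prod K L D) (reduced_le K L D)"
proof -
  note F = ultrafilter_onD(1)[OF D]
  let ?J = "dual_ideal K D"
  have J: "ideal_on K ?J" by (rule ideal_on_dual_ideal[OF F])
  have refl: "(X, X) \<in> reduced_le K L D" if X: "X \<in> reduced_prod K L D" for X
  proof -
    obtain f where "f \<in> X" "f \<in> card_prod K L" using reduced_prod_rep[OF F X] by blast
    then show ?thesis
      using reduced_le_iff[where L=L, OF F L X _ X] le_mod_pointwiseI[OF J] card_prod_refl L by metis
  qed
  then show "refl_on (reduced_prod K L D) (reduced_le K L D)" by (simp add: refl_on_def)
  show "trans (reduced_le K L D)"
  proof (rule transI)
    fix X Y Z assume *: "(X, Y) \<in> reduced_le K L D" "(Y, Z) \<in> reduced_le K L D"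
    then have XYZ: "X \<in> reduced_prod K L D" "Y \<in> reduced_prod K L D" "Z \<in> reduced_prod K L D"
      by (auto simp: reduced_le_def)
    obtain f g h where fgh: "f \<in> X" "g \<in> Y" "h \<in> Z"
      using reduced_prod_rep[OF F] XYZ by meson
    have "(f, g) \<in> le_mod K L ?J" "(g, h) \<in> le_mod K L ?J"
      using * reduced_le_iff[where L=L, OF F L] XYZ fgh by blast+
    then have "(f, h) \<in> le_mod K L ?J"
      using trans_le_mod[where L=L, OF J L] by (meson transD)
    then show "(X, Z) \<in> reduced_le K L D" using reduced_le_iff[where L=L, OF F L] XYZ fgh by blast
  qed
  show "total_on (reduced_prod K L D) (reduced_le K L D)"
  proof (rule total_onI)
    fix X Y assume XY: "X \<in> reduced_prod K L D" "Y \<in> reduced_prod K L D"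
    obtain f g where fg: "f \<in> X" "f \<in> card_prod K L" "g \<in> Y" "g \<in> card_prod K L"
      using reduced_prod_rep[OF F] XY by meson
    have "K - {i\<in>K. (f i, g i) \<in> L i} \<subseteq> {i\<in>K. (g i, f i) \<in> L i}"
      using fg card_order_props(1,4)[OF L] unfolding total_on_def refl_on_def card_prod_def
      by (smt (verit) DiffE PiE_E mem_Collect_eq subsetI)
    then have "{i\<in>K. (f i, g i) \<in> L i} \<in> D \<or> {i\<in>K. (g i, f i) \<in> L i} \<in> D"
      using ultrafilter_onD(3,4)[OF D] by (metis (no_types, lifting) mem_Collect_eq subsetI)
    then show "(X, Y) \<in> reduced_le K L D \<or> (Y, X) \<in> reduced_le K L D"
      using reduced_le_iff[where L=L, OF F L XY(1) fg(1) XY(2) fg(3)]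
        reduced_le_iff[where L=L, OF F L XY(2) fg(3) XY(1) fg(1)] fg(2,4)
      by (simp add: le_mod_dual_ideal_iff)
  qed
qed

text \<open>The transfer of \<open>tcf_directed\<close> from classes modulo \<open>D\<close> to functions.\<close>

lemma le_mod_ultrafilter_directed:
  assumes D: "ultrafilter_on K D" and L: "\<And>i. i \<in> K \<Longrightarrow> Card_order (L i)"
    and lam: "lam \<le>o tcf (reduced_prod K L D) (reduced_le K L D)"
  shows "directed_below (card_prod K L) (le_mod K L (dual_ideal K D)) lam"
  unfolding directed_below_def
proof (intro allI impI, elim conjE)
  fix A assume A: "A \<subseteq> card_prod K L" "|A| <o lam"
  note F = ultrafilter_onD(1)[OF D]
  let ?J = "dual_ideal K D"
  have eqv: "equiv (card_prod K L) (eq_mod K L ?J)"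
    by (rule equiv_eq_mod[OF ideal_on_dual_ideal[OF F]])
  define cls where "cls f = eq_mod K L ?J `` {f}" for f
  have cls: "cls f \<in> reduced_prod K L D" "f \<in> cls f" if "f \<in> A" for f
    using that A(1) equiv_class_self[OF eqv] quotientI[of f "card_prod K L" "eq_mod K L ?J"]
    unfolding cls_def reduced_prod_def by auto
  have "|cls ` A| <o lam" using card_of_image A(2) ordLeq_ordLess_trans by blast
  then obtain Y where Y: "Y \<in> reduced_prod K L D" "\<And>a. a \<in> A \<Longrightarrow> (cls a, Y) \<in> reduced_le K L D"
    using directed_belowD[OF tcf_directed[OF reduced_le_linear[where L=L, OF D L] lam], of "cls ` A"] cls(1)
    by (metis (no_types, lifting) image_eqI image_subsetI)
  obtain h where h: "h \<in> Y" "h \<in> card_prod K L" using reduced_prod_rep[OF F Y(1)] by blast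
  have "(a, h) \<in> le_mod K L ?J" if a: "a \<in> A" for a
    using reduced_le_iff[where L=L, OF F L cls(1)[OF a] cls(2)[OF a] Y(1) h(1)] Y(2)[OF a] by blast
  then show "\<exists>p\<in>card_prod K L. \<forall>a\<in>A. (a, p) \<in> le_mod K L ?J" using h(2) by blast
qed

text \<open>An ultrafilter is prime, so one that contains a union contains one of its two parts.\<close>

lemma ideal_on_J_less: "ideal_on K (J_less K I L lam)"
  unfolding ideal_on_def
proof (intro conjI ballI allI impI)
  show "J_less K I L lam \<subseteq> Pow K" by (auto simp: J_less_def)
  show "{} \<in> J_less K I L lam" by (auto simp: J_less_def ultrafilter_on_def)
next
  fix A B assume "A \<in> J_less K I L lam" "B \<subseteq> A"
  then show "B \<in> J_less K I L lam" unfolding J_less_def using ultrafilter_onD(4) by blast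
next
  fix A B assume AB: "A \<in> J_less K I L lam" "B \<in> J_less K I L lam"
  have prime: "A \<in> D \<or> B \<in> D" if D: "ultrafilter_on K D" and u: "A \<union> B \<in> D" for D
  proof (rule ccontr)
    assume *: "\<not> (A \<in> D \<or> B \<in> D)"
    have "A \<subseteq> K" "B \<subseteq> K" using AB by (auto simp: J_less_def)
    then have "K - A \<in> D" "K - B \<in> D" using ultrafilter_onD(3)[OF D] * by blast+
    then have "(A \<union> B) \<inter> ((K - A) \<inter> (K - B)) \<in> D" using ultrafilter_onD(5)[OF D] u by blast
    moreover have "(A \<union> B) \<inter> ((K - A) \<inter> (K - B)) = {}" by blast
    ultimately show False using ultrafilter_onD(2)[OF D] by simp
  qed
  show "A \<union> B \<in> J_less K I L lam" using AB prime unfolding J_less_def by blast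
qed

section \<open>Weak saturation\<close>

text \<open>
  The minimum that defines \<^const>\<open>wsat\<close> is over a nonempty set: choosing a point in each block of a
  partition is injective, so by Cantor's theorem no partition has as many blocks as the type of
  indices has subsets.
\<close>

lemma wsat_no_partition:
  assumes K: "K \<noteq> {}"
  shows "Card_order (wsat K I)" "Field (wsat K I) \<noteq> {}"
    "\<And>P. partition_on K P \<Longrightarrow> P \<subseteq> positive K I \<Longrightarrow> \<not> |P| =o wsat K I"
proof -
  let ?W = "{\<theta> :: 'a set rel. Card_order \<theta> \<and> Field \<theta> \<noteq> {} \<and>
     \<not> (\<exists>P. partition_on K P \<and> P \<subseteq> positive K I \<and> |P| =o \<theta>)}"
  have "|UNIV :: 'a set set| \<in> ?W"
  proof (intro CollectI conjI notI)
    assume "\<exists>P. partition_on K P \<and> P \<subseteq> positive K I \<and> |P| =o |UNIV :: 'a set set|"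
    then obtain P where P: "partition_on K P" "|P| =o |UNIV :: 'a set set|" by blast
    have "inj_on (\<lambda>X. SOME x. x \<in> X) P"
    proof (rule inj_onI)
      fix X Y assume XY: "X \<in> P" "Y \<in> P" and eq: "(SOME x. x \<in> X) = (SOME x. x \<in> Y)"
      then have "(SOME x. x \<in> X) \<in> X" "(SOME x. x \<in> Y) \<in> Y"
        using partition_onD3[OF P(1)] by (metis some_in_eq)+
      then show "X = Y" using partition_onD2[OF P(1)] XY eq by (metis disjointD disjoint_iff)
    qed
    then have "|P| \<le>o |UNIV :: 'a set|" using card_of_ordLeq by blast
    then have "|UNIV :: 'a set set| \<le>o |UNIV :: 'a set|"
      using P(2) ordIso_ordLeq_trans ordIso_symmetric by blast
    moreover have "|UNIV :: 'a set| <o |UNIV :: 'a set set|" using card_of_Pow[of "UNIV :: 'a set"] by simp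
    ultimately show False using not_ordLess_ordLeq by blast
  qed (simp_all add: card_of_card_order_on Field_card_of)
  then have "wsat K I \<in> ?W" unfolding wsat_def by (intro min_card_least(1)) auto
  then show "Card_order (wsat K I)" "Field (wsat K I) \<noteq> {}"
    "\<And>P. partition_on K P \<Longrightarrow> P \<subseteq> positive K I \<Longrightarrow> \<not> |P| =o wsat K I" by auto
qed

text \<open>
  A disjoint family of positive sets need not cover \<open>K\<close>, and may be longer than \<open>wsat K I\<close>. Keeping
  \<open>wsat K I\<close> many of its members and adding the uncovered indices to one of them gives a partition
  that \<^const>\<open>wsat\<close> excludes.
\<close>

lemma wsat_no_disjoint_family:
  fixes \<theta> :: "'t rel"
  assumes I: "ideal_on K I" and K: "K \<noteq> {}" and le: "wsat K I \<le>o \<theta>"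
    and pos: "\<And>e. e \<in> Field \<theta> \<Longrightarrow> A e \<in> positive K I"
    and disj: "disjoint_family_on A (Field \<theta>)"
  shows False
proof -
  note W = wsat_no_partition[where I=I, OF K]
  obtain S where S: "S \<subseteq> Field \<theta>" "wsat K I =o |S|"
    using internalize_card_of_ordLeq[of "Field (wsat K I)" \<theta>] le card_of_Field_ordIso[OF W(1)]
    by (meson ordIso_ordLeq_trans ordIso_symmetric ordIso_transitive)
  have "S \<noteq> {}"
    using S(2) W(2) by (metis Field_card_of card_of_empty2 card_of_Field_ordIso W(1) ordIso_transitive)
  then obtain s where s: "s \<in> S" by blast
  define B where "B e = (if e = s then A s \<union> (K - (\<Union>e\<in>S. A e)) else A e)" for e
  have AK: "A e \<subseteq> K" "A e \<notin> I" if "e \<in> S" for e using pos S(1) that by (auto simp: positive_def)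
  have sub: "A e \<subseteq> B e" "B e \<subseteq> K" if "e \<in> S" for e using AK that s by (auto simp: B_def)
  have Bpos: "B e \<in> positive K I" if "e \<in> S" for e
    using sub[OF that] AK[OF that] ideal_onD(2)[OF I] unfolding positive_def by blast
  have Bdisj: "B e \<inter> B e' = {}" if "e \<in> S" "e' \<in> S" "e \<noteq> e'" for e e'
  proof -
    have "A e \<inter> A e' = {}" using disj that S(1) unfolding disjoint_family_on_def by blast
    then show ?thesis using that unfolding B_def by auto
  qed
  have Bne: "B e \<noteq> {}" if "e \<in> S" for e
    using sub(1)[OF that] AK(2)[OF that] ideal_onD(1)[OF I] by auto
  have part: "partition_on K (B ` S)"
  proof (rule partition_onI)
    show "\<Union> (B ` S) = K"
    proof
      show "\<Union> (B ` S) \<subseteq> K" using sub(2) by blast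
      show "K \<subseteq> \<Union> (B ` S)"
      proof
        fix x assume "x \<in> K"
        then have "x \<in> B s \<or> (\<exists>e\<in>S. x \<in> A e)" by (auto simp: B_def)
        then show "x \<in> \<Union> (B ` S)" using sub(1) s by blast
      qed
    qed
    show "disjnt p q" if "p \<in> B ` S" "q \<in> B ` S" "p \<noteq> q" for p q
      using that Bdisj unfolding disjnt_def by blast
    show "{} \<notin> B ` S" using Bne by force
  qed
  have pos': "B ` S \<subseteq> positive K I" using Bpos by blast
  have "inj_on B S"
    using Bdisj Bne unfolding inj_on_def by (metis Int_absorb)
  then have "|B ` S| =o wsat K I"
    using S(2) card_of_ordIsoI[of B S "B ` S"] unfolding bij_betw_def
    by (meson ordIso_symmetric ordIso_transitive)
  then show False using W(3)[OF part pos'] by blast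
qed

section \<open>Directedness modulo the ideal of small true cofinality\<close>

text \<open>
  The core of the argument, carried out from the two facts that both alternatives of the theorem
  provide (the assumptions \<open>small\<close> and \<open>dir\<close>). An unbounded family \<open>F\<close> of least size yields a
  \<open>\<theta>\<close>-sequence of disjoint positive sets, as described at the beginning.
\<close>

lemma J_less_le_directed:
  fixes L :: "'k \<Rightarrow> 'a rel" and \<theta> :: "'t rel" and lam :: "'l rel"
  assumes I: "ideal_on K I" and K: "K \<noteq> {}"
    and L: "\<And>i. i \<in> K \<Longrightarrow> Card_order (L i) \<and> cinfinite (L i) \<and> regularCard (L i)"
    and \<theta>: "Card_order \<theta>" "wsat K I \<le>o \<theta>"
    and small: "\<And>e. e \<in> Field \<theta> \<Longrightarrow> {i\<in>K. L i \<le>o |underS \<theta> e| } \<in> I"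
    and dir: "directed_below (card_prod K L) (le_mod K L I) (cardSuc \<theta>)"
  shows "directed_below (card_prod K L) (le_mod K L (J_less K I L lam)) lam"
proof -
  let ?P = "card_prod K L" and ?J = "J_less K I L lam"
  let ?le = "le_mod K L ?J"
  have J: "ideal_on K ?J" by (rule ideal_on_J_less)
  have L': "\<And>i. i \<in> K \<Longrightarrow> Card_order (L i)" using L by blast
  note le_trans = transD[OF trans_le_mod[where L=L, OF J L']]
  have IJ: "I \<subseteq> ?J" using ideal_onD(4)[OF I] by (auto simp: J_less_def)
  define bdd where "bdd F \<longleftrightarrow> (\<exists>p\<in>?P. \<forall>f\<in>F. (f, p) \<in> ?le)" for F
  show ?thesis
  proof (rule ccontr)
    assume "\<not> ?thesis"
    then obtain F0 where "F0 \<subseteq> ?P \<and> |F0| <o lam \<and> \<not> bdd F0"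
      unfolding directed_below_def bdd_def by blast
    then obtain F where
      F: "F \<subseteq> ?P" "|F| <o lam" "\<not> bdd F" and
      least: "\<And>G. G \<subseteq> ?P \<Longrightarrow> |G| <o lam \<Longrightarrow> \<not> bdd G \<Longrightarrow> |F| \<le>o |G|"
      using exists_set_of_least_card[of "\<lambda>F. F \<subseteq> ?P \<and> |F| <o lam \<and> \<not> bdd F"] by metis
    have small_bdd: "bdd G" if G: "G \<subseteq> ?P" "|G| <o |F|" for G
      using least[OF G(1) ordLess_transitive[OF G(2) F(2)]] not_ordLess_ordLeq[OF G(2)] by blast
    have theta_lt: "\<theta> <o |F|"
    proof (rule ccontr)
      assume "\<not> \<theta> <o |F|"
      then have "|F| \<le>o \<theta>"
        using not_ordLess_iff_ordLeq card_order_props(6)[OF \<theta>(1)] card_of_Well_order by blast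
      then have "|F| <o cardSuc \<theta>" using cardSuc_ordLeq_ordLess[OF \<theta>(1) card_of_Card_order] by blast
      then obtain p where "p \<in> ?P" "\<And>f. f \<in> F \<Longrightarrow> (f, p) \<in> le_mod K L I"
        using directed_belowD[OF dir F(1)] by blast
      then show False using F(3) IJ unfolding bdd_def le_mod_def by blast
    qed
    \<comment> \<open>The members of \<open>F\<close> themselves serve as the ordinals below the cardinal of \<open>F\<close>.\<close>
    let ?r = "|F|"
    note ord = card_order_props[OF card_of_Card_order[of F]]
    have "\<exists>m\<in>?P. \<forall>b\<in>F. (b, a) \<in> ?r \<longrightarrow> (b, m) \<in> ?le" if a: "a \<in> F" for a
    proof -
      have "|underS ?r a| <o ?r" using a by (intro card_of_underS) (simp_all add: Field_card_of card_of_card_order_on)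
      moreover have "underS ?r a \<subseteq> ?P" using F(1) underS_Field[of _ ?r a] unfolding Field_card_of by blast
      ultimately obtain q where q: "q \<in> ?P" "\<forall>b\<in>underS ?r a. (b, q) \<in> ?le"
        using small_bdd unfolding bdd_def by blast
      obtain m where m: "m \<in> ?P" "\<forall>i\<in>K. (a i, m i) \<in> L i \<and> (q i, m i) \<in> L i"
        using card_prod_sup[of K L a q, OF L'] a F(1) q(1) by blast
      then have "(a, m) \<in> ?le" "(q, m) \<in> ?le"
        using le_mod_pointwiseI[OF J] a F(1) q(1) by blast+
      then have "(b, m) \<in> ?le" if "(b, a) \<in> ?r" for b
        using that q(2) le_trans by (cases "b = a") (auto simp: underS_def)
      then show ?thesis using m(1) by blast
    qed
    then obtain up where up: "\<And>a. a \<in> F \<Longrightarrow> up a \<in> ?P"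
      "\<And>a b. a \<in> F \<Longrightarrow> b \<in> F \<Longrightarrow> (b, a) \<in> ?r \<Longrightarrow> (b, up a) \<in> ?le"
      by metis
    \<comment> \<open>\<open>a\<close> and \<open>D\<close> refute that \<open>g\<close> bounds \<open>F\<close>, and \<open>h\<close> bounds all of \<open>up ` F\<close> modulo the same \<open>D\<close>.\<close>
    define refutes where "refutes g a D h \<longleftrightarrow>
        a \<in> F \<and> ultrafilter_on K D \<and> D \<inter> ?J = {} \<and> {i\<in>K. (a i, g i) \<notin> L i} \<in> D \<and>
        h \<in> ?P \<and> (\<forall>b\<in>F. {i\<in>K. (up b i, h i) \<in> L i} \<in> D)" for g a D h
    have "\<exists>a D h. refutes g a D h" if g: "g \<in> ?P" for g
    proof -
      obtain a where a: "a \<in> F" "(a, g) \<notin> ?le" using g F(3) unfolding bdd_def by blast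
      then have "{i\<in>K. (a i, g i) \<notin> L i} \<notin> ?J" using g F(1) by (auto simp: le_mod_def)
      then obtain D where D: "ultrafilter_on K D" "D \<inter> I = {}" "{i\<in>K. (a i, g i) \<notin> L i} \<in> D"
          "lam \<le>o tcf (reduced_prod K L D) (reduced_le K L D)"
        unfolding J_less_def by blast
      have "D \<inter> ?J = {}" using D(1,2,4) unfolding J_less_def by blast
      moreover have "|up ` F| <o lam" using card_of_image F(2) ordLeq_ordLess_trans by blast
      then obtain h where "h \<in> ?P" "\<forall>b\<in>F. (up b, h) \<in> le_mod K L (dual_ideal K D)"
        using directed_belowD[OF le_mod_ultrafilter_directed[where L=L, OF D(1) L' D(4)], of "up ` F"] up(1)
        by (metis (no_types, lifting) image_eqI image_subsetI)
      ultimately show ?thesis using a(1) D(1,3) le_mod_dual_ideal_iff unfolding refutes_def by blast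
    qed
    then obtain wit D H where "\<And>g. g \<in> ?P \<Longrightarrow> refutes g (wit g) (D g) (H g)" by metis
    then have
      wit: "\<And>g. g \<in> ?P \<Longrightarrow> wit g \<in> F" "\<And>g. g \<in> ?P \<Longrightarrow> {i\<in>K. (wit g i, g i) \<notin> L i} \<in> D g" and
      D: "\<And>g. g \<in> ?P \<Longrightarrow> ultrafilter_on K (D g)" "\<And>g. g \<in> ?P \<Longrightarrow> D g \<inter> ?J = {}" and
      H: "\<And>g. g \<in> ?P \<Longrightarrow> H g \<in> ?P"
         "\<And>g b. g \<in> ?P \<Longrightarrow> b \<in> F \<Longrightarrow> {i\<in>K. (up b i, H g i) \<in> L i} \<in> D g"
      unfolding refutes_def by blast+
    \<comment> \<open>The recursion may ignore the indices \<open>i\<close> with \<open>L i\<close> at most the size of the stage \<open>e\<close>, where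
      the earlier values can be unbounded.\<close>
    define ok where "ok g e x \<longleftrightarrow> x \<in> ?P \<and> (\<forall>i\<in>K. |underS \<theta> e| <o L i \<longrightarrow>
        (\<forall>z\<in>underS \<theta> e. (H (g z) i, x i) \<in> L i))" for g :: "'t \<Rightarrow> 'k \<Rightarrow> 'a" and e x
    have "\<exists>g. \<forall>e. ok g e (g e)"
    proof (rule dependent_wf_choice[OF card_order_props(5)[OF \<theta>(1)]])
      fix f g :: "'t \<Rightarrow> 'k \<Rightarrow> 'a" and e x
      assume "\<And>z. (z, e) \<in> \<theta> - Id \<Longrightarrow> f z = g z"
      then have "f z = g z" if "z \<in> underS \<theta> e" for z using that by (auto simp: underS_def)
      then show "ok f e x = ok g e x" unfolding ok_def by auto
    next
      fix e g
      assume IH: "\<And>z. (z, e) \<in> \<theta> - Id \<Longrightarrow> ok g z (g z)"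
      have Hg: "H (g z) \<in> ?P" if "z \<in> underS \<theta> e" for z
        using IH[of z] H(1) that by (auto simp: underS_def ok_def)
      have "\<exists>b\<in>Field (L i). |underS \<theta> e| <o L i \<longrightarrow> (\<forall>z\<in>underS \<theta> e. (H (g z) i, b) \<in> L i)"
        if i: "i \<in> K" for i
      proof (cases "|underS \<theta> e| <o L i")
        case True
        let ?X = "(\<lambda>z. H (g z) i) ` underS \<theta> e"
        have "?X \<subseteq> Field (L i)" using Hg i by (auto simp: card_prod_def)
        moreover have "|?X| <o L i" using True card_of_image ordLeq_ordLess_trans by blast
        ultimately show ?thesis using regularCard_bounded[of "L i" ?X] L[OF i] by auto
      next
        case False
        have "Field (L i) \<noteq> {}" using L[OF i] unfolding cinfinite_def by auto
        then show ?thesis using False by auto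
      qed
      from card_prod_choice[of K L, OF this] show "\<exists>x. ok g e x"
        unfolding ok_def by auto
    qed
    then obtain g where "\<And>e. ok g e (g e)" by blast
    then have g: "\<And>e. g e \<in> ?P"
      "\<And>e z i. i \<in> K \<Longrightarrow> |underS \<theta> e| <o L i \<Longrightarrow> z \<in> underS \<theta> e \<Longrightarrow> (H (g z) i, g e i) \<in> L i"
      unfolding ok_def by auto
    \<comment> \<open>The witnesses for all stages are not cofinal in \<open>F\<close>: some \<open>b\<close> in \<open>F\<close> is above all of them.\<close>
    let ?X = "(\<lambda>e. wit (g e)) ` Field \<theta>"
    have X: "?X \<subseteq> F" using wit(1) g(1) by blast
    have "|up ` ?X| \<le>o |Field \<theta>|" by (rule ordLeq_transitive[OF card_of_image card_of_image])
    also have "|Field \<theta>| =o \<theta>" by (rule card_of_Field_ordIso[OF \<theta>(1)])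
    also note theta_lt
    finally have "bdd (up ` ?X)" using X up(1) by (intro small_bdd) auto
    then obtain p where p: "p \<in> ?P" "\<And>e. e \<in> Field \<theta> \<Longrightarrow> (up (wit (g e)), p) \<in> ?le"
      unfolding bdd_def by blast
    obtain b where b: "b \<in> F" "(b, p) \<notin> ?le" using p(1) F(3) unfolding bdd_def by blast
    have wit_le: "(wit (g e), up b) \<in> ?le" if e: "e \<in> Field \<theta>" for e
    proof -
      have w: "wit (g e) \<in> F" using wit(1) g(1) by blast
      have "(b, wit (g e)) \<notin> ?r" using up(2)[OF w b(1)] p(2)[OF e] b(2) le_trans by blast
      then have "(wit (g e), b) \<in> ?r"
        using ord(1,4) w b(1) unfolding total_on_def refl_on_def by (metis Field_card_of)
      then show ?thesis using up(2) b(1) w by blast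
    qed
    define A where "A e = {i\<in>K. (up b i, g e i) \<notin> L i \<and> (up b i, H (g e) i) \<in> L i \<and>
        |underS \<theta> e| <o L i}" for e
    have "A e \<in> positive K I" if e: "e \<in> Field \<theta>" for e
    proof -
      \<comment> \<open>Up to a set in \<open>J\<close>, \<open>A e\<close> contains the intersection of two sets in the ultrafilter for \<open>g e\<close>:
        where the witness exceeds \<open>g e\<close>, and where \<open>up b\<close> is at most \<open>H (g e)\<close>.\<close>
      note U = ultrafilter_onD[OF D(1)[OF g(1)[of e]]]
      have co: "K - B \<in> D (g e)" if "B \<in> ?J" for B
        using U(3)[OF ideal_onD(4)[OF J that]] D(2)[OF g(1)[of e]] that by blast
      have 1: "K - {i\<in>K. (wit (g e) i, up b i) \<notin> L i} \<in> D (g e)"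
        using wit_le[OF e] by (intro co) (auto simp: le_mod_def)
      have 2: "K - {i\<in>K. L i \<le>o |underS \<theta> e| } \<in> D (g e)"
        using small[OF e] IJ by (intro co) auto
      have "(K - {i\<in>K. (wit (g e) i, up b i) \<notin> L i}) \<inter> (K - {i\<in>K. L i \<le>o |underS \<theta> e| }) \<inter>
          {i\<in>K. (wit (g e) i, g e i) \<notin> L i} \<inter> {i\<in>K. (up b i, H (g e) i) \<in> L i} \<in> D (g e)"
        by (rule U(5)[OF U(5)[OF U(5)[OF 1 2] wit(2)[OF g(1)]] H(2)[OF g(1) b(1)]])
      moreover have "(K - {i\<in>K. (wit (g e) i, up b i) \<notin> L i}) \<inter> (K - {i\<in>K. L i \<le>o |underS \<theta> e| }) \<inter>
          {i\<in>K. (wit (g e) i, g e i) \<notin> L i} \<inter> {i\<in>K. (up b i, H (g e) i) \<in> L i} \<subseteq> A e"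
      proof
        fix i assume i: "i \<in> (K - {i\<in>K. (wit (g e) i, up b i) \<notin> L i}) \<inter> (K - {i\<in>K. L i \<le>o |underS \<theta> e| }) \<inter>
          {i\<in>K. (wit (g e) i, g e i) \<notin> L i} \<inter> {i\<in>K. (up b i, H (g e) i) \<in> L i}"
        then have iK: "i \<in> K" by blast
        have "|underS \<theta> e| <o L i"
          using i not_ordLeq_iff_ordLess card_of_Well_order card_order_props(6)[OF L'[OF iK]] by blast
        moreover have "(up b i, g e i) \<notin> L i"
          using i transD[OF card_order_props(2)[OF L'[OF iK]]] by blast
        ultimately show "i \<in> A e" using i unfolding A_def by blast
      qed
      ultimately have "A e \<in> D (g e)" using U(4) unfolding A_def by blast
      then have "A e \<notin> I" using D(2)[OF g(1)[of e]] IJ by blast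
      then show ?thesis unfolding positive_def A_def by blast
    qed
    moreover have "disjoint_family_on A (Field \<theta>)"
    proof -
      have *: "A z \<inter> A e = {}" if "z \<in> underS \<theta> e" for z e
      proof (rule ccontr)
        assume "A z \<inter> A e \<noteq> {}"
        then obtain i where i: "i \<in> K" "(up b i, g e i) \<notin> L i" "(up b i, H (g z) i) \<in> L i"
            "|underS \<theta> e| <o L i"
          unfolding A_def by blast
        \<comment> \<open>At \<open>i\<close>, \<open>up b \<le> H (g z) \<le> g e < up b\<close>.\<close>
        then show False
          using g(2)[OF i(1,4) that] transD[OF card_order_props(2)[OF L'[OF i(1)]]] by blast
      qed
      show ?thesis
        unfolding disjoint_family_on_def
      proof (intro ballI impI)
        fix z e assume "z \<in> Field \<theta>" "e \<in> Field \<theta>" "z \<noteq> e"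
        then have "z \<in> underS \<theta> e \<or> e \<in> underS \<theta> z"
          using card_order_props(4)[OF \<theta>(1)] unfolding total_on_def underS_def by auto
        then show "A z \<inter> A e = {}" using *[of z e] *[of e z] by blast
      qed
    qed
    ultimately show False by (rule wsat_no_disjoint_family[OF I K \<theta>(2)])
  qed
qed

section \<open>The two alternatives\<close>

text \<open>
  A cardinal below \<open>liminf_card K I L\<close> is represented by a cardinal on the type \<open>'a\<close>, and so it
  competes in the minimum; being smaller, it cannot bound positively many \<open>L i\<close>.
\<close>

lemma liminf_small_in_ideal:
  fixes L :: "'k \<Rightarrow> 'a rel" and \<theta> :: "'t rel"
  assumes I: "proper_ideal_on K I" and L: "\<And>i. i \<in> K \<Longrightarrow> Card_order (L i)"
    and \<theta>: "\<theta> \<le>o liminf_card K I L" and X: "|X :: 't set| <o \<theta>"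
  shows "{i\<in>K. L i \<le>o |X| } \<in> I"
proof (rule ccontr)
  assume no: "{i\<in>K. L i \<le>o |X| } \<notin> I"
  let ?M = "{\<mu> :: 'a rel. Card_order \<mu> \<and> {i\<in>K. L i \<le>o \<mu>} \<in> positive K I}"
  have "L i \<le>o |UNIV :: 'a set|" if "i \<in> K" for i
    using card_of_Field_ordIso[OF L[OF that]] card_of_mono1[of "Field (L i)" UNIV]
      ordIso_ordLeq_trans ordIso_symmetric by blast
  then have "{i\<in>K. L i \<le>o |UNIV :: 'a set| } = K" by blast
  then have U: "|UNIV :: 'a set| \<in> ?M"
    using I by (auto simp: positive_def proper_ideal_on_def card_of_Card_order)
  have least: "\<mu> \<in> ?M \<Longrightarrow> liminf_card K I L \<le>o \<mu>" for \<mu>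
    unfolding liminf_card_def using U by (intro min_card_least(2)) auto
  have lt: "|X| <o liminf_card K I L" using X \<theta> ordLess_ordLeq_trans by blast
  then obtain Y :: "'a set" where Y: "|X| =o |Y|"
    using internalize_card_of_ordLeq ordLess_imp_ordLeq by meson
  have "L i \<le>o |X| \<longleftrightarrow> L i \<le>o |Y|" for i
    using Y ordLeq_ordIso_trans ordIso_symmetric by metis
  then have "|Y| \<in> ?M" using no by (auto simp: positive_def card_of_Card_order)
  then have "liminf_card K I L \<le>o |X|"
    using least Y ordLeq_ordIso_trans ordIso_symmetric by blast
  then show False using lt not_ordLess_ordLeq by blast
qed

text \<open>Fewer than \<open>L i\<close> values are bounded at each index, so upper bounds exist pointwise.\<close>

lemma le_mod_cardSuc_directed:
  fixes L :: "'k \<Rightarrow> 'a rel" and \<theta> :: "'t rel"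
  assumes I: "ideal_on K I" and \<theta>: "Card_order \<theta>"
    and L: "\<And>i. i \<in> K \<Longrightarrow> Card_order (L i) \<and> regularCard (L i) \<and> \<theta> <o L i"
  shows "directed_below (card_prod K L) (le_mod K L I) (cardSuc \<theta>)"
  unfolding directed_below_def
proof (intro allI impI, elim conjE)
  fix A assume A: "A \<subseteq> card_prod K L" "|A| <o cardSuc \<theta>"
  have le: "|A| \<le>o \<theta>" using A(2) cardSuc_ordLeq_ordLess[OF \<theta> card_of_Card_order] by blast
  have "\<exists>b\<in>Field (L i). \<forall>f\<in>A. (f i, b) \<in> L i" if i: "i \<in> K" for i
  proof -
    have "|(\<lambda>f. f i) ` A| <o L i"
      using card_of_image le L[OF i] ordLeq_ordLess_trans by metis
    moreover have "(\<lambda>f. f i) ` A \<subseteq> Field (L i)" using A(1) i by (auto simp: card_prod_def)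
    ultimately show ?thesis using regularCard_bounded[of "L i" "(\<lambda>f. f i) ` A"] L[OF i] by auto
  qed
  from card_prod_choice[of K L, OF this] obtain p where
    p: "p \<in> card_prod K L" "\<And>i f. i \<in> K \<Longrightarrow> f \<in> A \<Longrightarrow> (f i, p i) \<in> L i" by blast
  then show "\<exists>p\<in>card_prod K L. \<forall>a\<in>A. (a, p) \<in> le_mod K L I"
    using A(1) le_mod_pointwiseI[OF I] by (meson subsetD)
qed

theorem lemma1p5:
  fixes \<kappa> :: "'k rel" and I :: "'k set set" and L :: "'k \<Rightarrow> 'a rel"
    and \<theta> :: "'t rel" and lam :: "'l rel"
  assumes kappa: "Card_order \<kappa>" "cinfinite \<kappa>"
    and ideal: "proper_ideal_on (Field \<kappa>) I"
    and regular: "\<And>i. i \<in> Field \<kappa> \<Longrightarrow> Card_order (L i) \<and> cinfinite (L i) \<and> regularCard (L i)"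
    and theta: "Card_order \<theta>"
    and alpha_or_beta:
      "(\<theta> <o min_card (L ` Field \<kappa>) \<and> wsat (Field \<kappa>) I \<le>o \<theta>) \<or>
       (\<theta> \<le>o liminf_card (Field \<kappa>) I L \<and> wsat (Field \<kappa>) I \<le>o \<theta> \<and>
        directed_below (card_prod (Field \<kappa>) L) (le_mod (Field \<kappa>) L I) (cardSuc \<theta>))"
    and lambda: "Card_order lam" "\<theta> \<le>o lam"
    and kappa_notin: "Field \<kappa> \<notin> J_less (Field \<kappa>) I L lam"
  shows "directed_below (card_prod (Field \<kappa>) L)
           (less_mod (Field \<kappa>) L (J_less (Field \<kappa>) I L lam)) lam"
proof -
  let ?K = "Field \<kappa>"
  have K: "?K \<noteq> {}" using kappa(2) unfolding cinfinite_def by auto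
  have I: "ideal_on ?K I" using ideal by (simp add: proper_ideal_on_def)
  have wsat: "wsat ?K I \<le>o \<theta>" using alpha_or_beta by blast
  have small_dir: "(\<forall>e\<in>Field \<theta>. {i\<in>?K. L i \<le>o |underS \<theta> e| } \<in> I) \<and>
      directed_below (card_prod ?K L) (le_mod ?K L I) (cardSuc \<theta>)"
    using alpha_or_beta
  proof (elim disjE conjE)
    assume lt: "\<theta> <o min_card (L ` ?K)"
    have L: "\<theta> <o L i" if "i \<in> ?K" for i
    proof -
      have "min_card (L ` ?K) \<le>o L i" using that regular by (intro min_card_least(2)) auto
      then show ?thesis using lt ordLess_ordLeq_trans by blast
    qed
    have "{i\<in>?K. L i \<le>o |underS \<theta> e| } \<in> I" if e: "e \<in> Field \<theta>" for e
    proof -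
      have "{i\<in>?K. L i \<le>o |underS \<theta> e| } = {}"
        using L ordLess_transitive[OF card_of_underS[OF theta e]] not_ordLess_ordLeq by blast
      then show ?thesis by (simp only: ideal_onD(1)[OF I])
    qed
    then show ?thesis
      using le_mod_cardSuc_directed[where L=L, OF I theta] L regular by simp
  next
    assume "\<theta> \<le>o liminf_card ?K I L"
      and dir: "directed_below (card_prod ?K L) (le_mod ?K L I) (cardSuc \<theta>)"
    then have "{i\<in>?K. L i \<le>o |underS \<theta> e| } \<in> I" if "e \<in> Field \<theta>" for e
      using liminf_small_in_ideal[OF ideal, of L \<theta>] regular card_of_underS[OF theta that] by blast
    then show ?thesis using dir by blast
  qed
  have "directed_below (card_prod ?K L) (le_mod ?K L (J_less ?K I L lam)) lam"
    using J_less_le_directed[where L=L, OF I K regular theta wsat] small_dir by blast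
  then show ?thesis
    by (rule less_mod_directed[OF ideal_on_J_less, rotated]) (use regular in simp)
qed

end
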